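(* Let $A:\mathbb{R}^n\rightrightarrows\mathbb{R}^n$ be a set-valued operator that is partly smooth at $\bar x$ relative to a $C^p$-manifold $\mathcal{M}\subset\mathbb{R}^n$ ($p\ge1$), and suppose $A$ is $r$-resolvent-regular at $\bar x$ for $\bar u\in A(\bar x)$. For $\gamma\in\,]0,1/r[$ and sufficiently small $\varepsilon>0$, define $$\mathcal{U}_{\varepsilon,\gamma}=\bigcup_{x\in\mathcal{M}\cap B_\varepsilon(\bar x)}\bigl(x+\gamma A_\varepsilon(x)\bigr),$$ where $A_\varepsilon$ is the $\varepsilon$-localization of $A$ around $(\bar x,\bar u)$. Then (i) $\operatorname{span}(\mathcal{U}_{\varepsilon,\gamma})=\mathbb{R}^n$ (linear span); (ii) $J_{\gamma A_\varepsilon}(\mathcal{U}_{\varepsilon,\gamma})=\mathcal{M}\cap B_\varepsilon(\bar x)$, where $J_{\gamma A_\varepsilon}=(\mathrm{Id}+\gamma A_\varepsilon)^{-1}$.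
   Context: Notation. $B_\varepsilon(\bar x)=\{x:\|x-\bar x\|<\varepsilon\}$. For a convex set $S$, $\operatorname{Lin}(S)=\operatorname{Aff}(S)-x$ ($x\in S$) is the linear subspace parallel to the affine hull of $S$. $T_{\mathcal{M}}(x)$, $N_{\mathcal{M}}(x)$ are the tangent and normal spaces of the manifold $\mathcal{M}$ at $x\in\mathcal{M}$; $P_V$ is the orthogonal projection onto $V$. Semicontinuity. $A$ is lower semi-continuous at $\bar x$ if for every $\bar u\in A(\bar x)$ and every sequence $x^{(k)}\in\operatorname{dom}A$ with $x^{(k)}\to\bar x$ there are $u^{(k)}\in A(x^{(k)})$ with $u^{(k)}\to\bar u$. $A$ is upper semi-continuous at $\bar x$ if $x^{(k)}\to\bar x$, $u^{(k)}\in A(x^{(k)})$, $u^{(k)}\to\bar u$ imply $\bar u\in A(\bar x)$. $A$ is upper semi-continuous if it is so at every point of its domain. Continuous along $\mathcal{M}$ means both lower and upper semi-continuous with sequences restricted to $\mathcal{M}$. Partly smooth operator. $A$ is partly smooth at $\bar x$ relative to a set $\mathcal{M}\ni\bar x$ if $\mathcal{M}$ is a $C^p$-manifold around $\bar x$, $A$ is upper semi-continuous, and: (Regularity) for every $x$ close to $\bar x$, $A(x)$ is nonempty, closed and convex; (Sharpness) $N_{\mathcal{M}}(\bar x)=\operatorname{Lin}(A(\bar x))$, and $x\mapsto P_{T_{\mathcal{M}}(x)}(A(x))$ is single-valued and continuous around $\bar x$ along $\mathcal{M}$; (Continuity) $A$ is continuous along $\mathcal{M}$ near $\bar x$. Localization.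 For $\varepsilon>0$ the $\varepsilon$-localization of $A$ around $(\bar x,\bar u)\in\operatorname{gra}(A)$ is $A_\varepsilon(x)=\{u\in A(x):\|u-\bar u\|<\varepsilon\}$ if $\|x-\bar x\|<\varepsilon$, and $A_\varepsilon(x)=\emptyset$ otherwise. Resolvent-regularity. $A$ is ($r$-)resolvent-regular at $\bar x$ for $\bar u\in A(\bar x)$ if there are $\varepsilon>0$ and $r>0$ such that $r\,\mathrm{Id}+A_\varepsilon$ is monotone and, for each $\gamma\in\,]0,1/r[$, there is a neighbourhood of $\bar x+\gamma\bar u$ on which the resolvent $J_{\gamma A_\varepsilon}=(\mathrm{Id}+\gamma A_\varepsilon)^{-1}$ is single-valued and continuous.
   Formalization: (ii) fails as stated (A(x)={2x}, M=R^n, x̄=ū=0: A_ε(x) is empty for ε/2≤|x|<ε). Proved instead: J(U)=M∩B_ε(x̄)∩dom A_ε; and with the union over M∩B_δ(x̄) for all small δ>0, J(U)=M∩B_δ(x̄) and span U=R^n. *)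

theory Defs
  imports "HOL-Analysis.Analysis"
begin

text \<open>
  Set-valued operators on a Euclidean space are functions \<open>A :: 'a \<Rightarrow> 'a set\<close>; the graph of \<open>A\<close> is
  \<open>{(x, u). u \<in> A x}\<close>.
\<close>

definition op_dom :: "('a \<Rightarrow> 'b set) \<Rightarrow> 'a set" where
  "op_dom A = {x. A x \<noteq> {}}"

definition op_inverse :: "('a \<Rightarrow> 'b set) \<Rightarrow> 'b \<Rightarrow> 'a set" where
  "op_inverse A y = {x. y \<in> A x}"

definition monotone_op :: "('a::euclidean_space \<Rightarrow> 'a set) \<Rightarrow> bool" where
  "monotone_op A \<longleftrightarrow> (\<forall>x y. \<forall>u\<in>A x. \<forall>v\<in>A y. 0 \<le> (x - y) \<bullet> (u - v))"

definition resolvent :: "real \<Rightarrow> ('a::euclidean_space \<Rightarrow> 'a set) \<Rightarrow> 'a \<Rightarrow> 'a set" where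
  "resolvent \<gamma> A = op_inverse (\<lambda>x. (\<lambda>u. x + \<gamma> *\<^sub>R u) ` A x)"

definition single_valued_continuous_on ::
    "'a::topological_space set \<Rightarrow> ('a \<Rightarrow> 'b::topological_space set) \<Rightarrow> bool" where
  "single_valued_continuous_on S F \<longleftrightarrow> (\<exists>f. continuous_on S f \<and> (\<forall>x\<in>S. F x = {f x}))"

text \<open>
  Semicontinuity at \<open>x\<close> with sequences restricted to \<open>S\<close>; the unrestricted notions are those with
  \<open>S = UNIV\<close>.
\<close>

definition lsc_at_along ::
    "'a::euclidean_space set \<Rightarrow> ('a \<Rightarrow> 'a set) \<Rightarrow> 'a \<Rightarrow> bool" where
  "lsc_at_along S A x \<longleftrightarrow>
     (\<forall>u\<in>A x. \<forall>X. (\<forall>k. X k \<in> S \<inter> op_dom A) \<longrightarrow> X \<longlonglongrightarrow> x \<longrightarrow>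
        (\<exists>Y. (\<forall>k. Y k \<in> A (X k)) \<and> Y \<longlonglongrightarrow> u))"

definition usc_at_along ::
    "'a::euclidean_space set \<Rightarrow> ('a \<Rightarrow> 'a set) \<Rightarrow> 'a \<Rightarrow> bool" where
  "usc_at_along S A x \<longleftrightarrow>
     (\<forall>X Y u. (\<forall>k. X k \<in> S \<and> Y k \<in> A (X k)) \<longrightarrow> X \<longlonglongrightarrow> x \<longrightarrow> Y \<longlonglongrightarrow> u \<longrightarrow> u \<in> A x)"

definition usc :: "('a::euclidean_space \<Rightarrow> 'a set) \<Rightarrow> bool" where
  "usc A \<longleftrightarrow> (\<forall>x\<in>op_dom A. usc_at_along UNIV A x)"

text \<open>
  Class \<open>C\<^sup>k\<close> on an open set: in finite dimension, the derivative is of class \<open>C\<^sup>k\<close> iff all directional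
  derivatives \<open>x \<mapsto> Df(x) v\<close> are.
\<close>

primrec Ck_on :: "nat \<Rightarrow> 'a::euclidean_space set \<Rightarrow> ('a \<Rightarrow> 'b::euclidean_space) \<Rightarrow> bool" where
  "Ck_on 0 S f \<longleftrightarrow> continuous_on S f"
| "Ck_on (Suc k) S f \<longleftrightarrow>
     (\<forall>x\<in>S. f differentiable (at x)) \<and> (\<forall>v. Ck_on k S (\<lambda>x. frechet_derivative f (at x) v))"

text \<open>
  Embedded \<open>C\<^sup>p\<close>-submanifold near a point, via a straightening chart: a \<open>C\<^sup>p\<close>-diffeomorphism \<open>\<phi>\<close> between
  open sets (with inverse \<open>\<psi>\<close>) that maps \<open>M\<close> locally onto a linear subspace \<open>L\<close>, whose dimension is
  that of the manifold.
\<close>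

definition Cp_manifold_around :: "nat \<Rightarrow> 'a::euclidean_space set \<Rightarrow> 'a \<Rightarrow> bool" where
  "Cp_manifold_around p M x \<longleftrightarrow> x \<in> M \<and>
     (\<exists>V W \<phi> \<psi> L. open V \<and> open W \<and> x \<in> V \<and> subspace (L :: 'a set) \<and>
        homeomorphism V W \<phi> \<psi> \<and> Ck_on p V \<phi> \<and> Ck_on p W \<psi> \<and> \<phi> ` (M \<inter> V) = L \<inter> W)"

definition tangent_space :: "'a::euclidean_space set \<Rightarrow> 'a \<Rightarrow> 'a set" where
  "tangent_space M x =
     {v. \<exists>c e. 0 < e \<and> (\<forall>t\<in>{-e<..<e}. c t \<in> M) \<and> c 0 = x \<and> (c has_vector_derivative v) (at (0::real))}"

definition normal_space :: "'a::euclidean_space set \<Rightarrow> 'a \<Rightarrow> 'a set" where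
  "normal_space M x = orthogonal_comp (tangent_space M x)"

definition Lin :: "'a::euclidean_space set \<Rightarrow> 'a set" where
  "Lin S = {y - x | x y. x \<in> S \<and> y \<in> affine hull S}"

text \<open>
  In the sharpness condition, \<open>closest_point (tangent_space M x)\<close> is the orthogonal projection onto the
  tangent space.
\<close>

definition partly_smooth ::
    "nat \<Rightarrow> ('a::euclidean_space \<Rightarrow> 'a set) \<Rightarrow> 'a \<Rightarrow> 'a set \<Rightarrow> bool" where
  "partly_smooth p A xbar M \<longleftrightarrow>
     Cp_manifold_around p M xbar \<and>
     usc A \<and>
     (\<forall>\<^sub>F x in nhds xbar. A x \<noteq> {} \<and> closed (A x) \<and> convex (A x)) \<and>
     normal_space M xbar = Lin (A xbar) \<and>
     (\<exists>V. open V \<and> xbar \<in> V \<and>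
        single_valued_continuous_on (M \<inter> V) (\<lambda>x. closest_point (tangent_space M x) ` A x)) \<and>
     (\<forall>\<^sub>F x in nhds xbar. x \<in> M \<longrightarrow> lsc_at_along M A x \<and> usc_at_along M A x)"

definition localization ::
    "('a::euclidean_space \<Rightarrow> 'a set) \<Rightarrow> 'a \<Rightarrow> 'a \<Rightarrow> real \<Rightarrow> 'a \<Rightarrow> 'a set" where
  "localization A xbar ubar \<epsilon> x =
     (if norm (x - xbar) < \<epsilon> then {u \<in> A x. norm (u - ubar) < \<epsilon>} else {})"

definition resolvent_regular ::
    "real \<Rightarrow> ('a::euclidean_space \<Rightarrow> 'a set) \<Rightarrow> 'a \<Rightarrow> 'a \<Rightarrow> bool" where
  "resolvent_regular r A xbar ubar \<longleftrightarrow> 0 < r \<and>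
     (\<exists>\<epsilon>>0. monotone_op (\<lambda>x. (\<lambda>u. r *\<^sub>R x + u) ` localization A xbar ubar \<epsilon> x) \<and>
        (\<forall>\<gamma>. 0 < \<gamma> \<longrightarrow> \<gamma> < 1 / r \<longrightarrow>
           (\<exists>W. open W \<and> xbar + \<gamma> *\<^sub>R ubar \<in> W \<and>
              single_valued_continuous_on W (resolvent \<gamma> (localization A xbar ubar \<epsilon>)))))"

text \<open>
  The union of the sets \<open>x + \<gamma> B(x)\<close> over \<open>x \<in> S\<close>. The index set is kept separate from the localization
  radius: for \<open>B = localization A xbar ubar \<epsilon>\<close> and \<open>S = M \<inter> ball xbar \<epsilon>\<close>, points \<open>x \<in> S\<close> with \<open>B x = {}\<close>
  contribute nothing, and they can occur for every \<open>\<epsilon>\<close> (e.g. \<open>A x = {2 x}\<close>, \<open>M = UNIV\<close>,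
  \<open>xbar = ubar = 0\<close>). Lower semicontinuity along \<open>M\<close> rules them out on \<open>M \<inter> ball xbar \<delta>\<close> for small \<open>\<delta>\<close>.
\<close>

definition lifted_set ::
    "real \<Rightarrow> ('a::euclidean_space \<Rightarrow> 'a set) \<Rightarrow> 'a set \<Rightarrow> 'a set" where
  "lifted_set \<gamma> B S = (\<Union>x\<in>S. (\<lambda>u. x + \<gamma> *\<^sub>R u) ` B x)"

definition op_image :: "('a \<Rightarrow> 'b set) \<Rightarrow> 'a set \<Rightarrow> 'b set" where
  "op_image F S = (\<Union>y\<in>S. F y)"

end

theory Submission
  imports Defs
begin

text \<open>
  Since \<open>r \<gamma> < 1\<close>, monotonicity of \<open>r Id + A\<^sub>\<epsilon>\<close> makes the sets \<open>x + \<gamma> A\<^sub>\<epsilon>(x)\<close> pairwise disjoint, which gives (ii).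
  For (i), let \<open>z\<close> be orthogonal to the union of these sets. The set over \<open>xbar\<close> forces \<open>z\<close> to be orthogonal to
  \<open>Lin (A xbar)\<close>, hence tangent to \<open>M\<close>. If \<open>z \<noteq> 0\<close>, there are points \<open>x \<in> M\<close> with \<open>x - xbar = t z + n\<close>, where \<open>n\<close> is
  normal and \<open>o(t)\<close>. For \<open>u \<in> A\<^sub>\<epsilon>(x)\<close> close to a relative interior point \<open>u\<^sub>0\<close> of \<open>A xbar\<close>, orthogonality gives
  \<open>\<gamma> z \<bullet> (u - u\<^sub>0) = - t \<bar>z\<bar>\<^sup>2\<close>, whereas monotonicity gives \<open>z \<bullet> (u - u\<^sub>0) \<ge> - r t \<bar>z\<bar>\<^sup>2 - o(t)\<close>: a contradiction.
\<close>

section \<open>Orthogonal projections and straightening charts\<close>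

text \<open>Writing the projection as a sum of Gram-Schmidt coefficients over an orthogonal basis
  makes it visibly linear; the norm bounds come from Pythagoras.\<close>

lemma orthogonal_projection_exists:
  fixes T :: "'a::euclidean_space set"
  assumes "subspace T"
  obtains P where "linear P" "\<And>v. P v \<in> T" "\<And>v w. w \<in> T \<Longrightarrow> w \<bullet> (v - P v) = 0"
    "\<And>v. v \<in> T \<Longrightarrow> P v = v" "\<And>v. norm (v - P v) \<le> norm v" "\<And>v. norm (P v) \<le> norm v"
proof -
  obtain B where B: "B \<subseteq> T" "pairwise orthogonal B" "independent B" "span B = T"
    using orthogonal_basis_subspace[OF assms] by metis
  define P where "P v = (\<Sum>b\<in>B. (b \<bullet> v / (b \<bullet> b)) *\<^sub>R b)" for v
  have lin: "linear P"
    unfolding P_def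
    by (rule linearI)
      (simp_all add: inner_add_right add_divide_distrib scaleR_add_left sum.distrib scaleR_sum_right)
  have mem: "P v \<in> T" for v
    unfolding P_def using B assms by (intro subspace_sum subspace_scale) auto
  have orth: "w \<bullet> (v - P v) = 0" if "w \<in> T" for v w
    using Gram_Schmidt_step[OF B(2), of w v] that B(4) by (simp add: orthogonal_def P_def)
  have id: "P v = v" if "v \<in> T" for v
  proof -
    have "v - P v \<in> T"
      using assms that mem by (simp add: subspace_diff)
    then have "(v - P v) \<bullet> (v - P v) = 0"
      by (rule orth)
    then show ?thesis by simp
  qed
  have pyth: "(norm v)\<^sup>2 = (norm (P v))\<^sup>2 + (norm (v - P v))\<^sup>2" for v
    using norm_add_Pythagorean[of "P v" "v - P v"] orth[OF mem[of v], of v]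
    by (simp add: orthogonal_def)
  have "norm (v - P v) \<le> norm v" "norm (P v) \<le> norm v" for v
    by (rule power2_le_imp_le[of _ "norm v"]; simp add: pyth[of v])+
  with that[OF lin mem] orth id show thesis by blast
qed

text \<open>Derivatives are recorded only at \<open>x\<close> and \<open>\<phi> x\<close>. They are
  inverse to each other, and \<open>D\<close> carries the model subspace \<open>L\<close> onto the
  tangent space.\<close>

locale straightening_chart =
  fixes M V W L :: "'a::euclidean_space set" and x :: 'a and \<phi> \<psi> D E :: "'a \<Rightarrow> 'a"
  assumes open_V: "open V" and open_W: "open W"
    and x_M: "x \<in> M" and x_V: "x \<in> V"
    and L: "subspace L"
    and hom: "homeomorphism V W \<phi> \<psi>"
    and image_M: "\<phi> ` (M \<inter> V) = L \<inter> W"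
    and der_\<phi>: "(\<phi> has_derivative E) (at x)"
    and der_\<psi>: "(\<psi> has_derivative D) (at (\<phi> x))"
begin

section \<open>Derivatives of the chart and the tangent space\<close>

lemma \<phi>_x: "\<phi> x \<in> L" "\<phi> x \<in> W"
  using image_M x_M x_V by auto

lemma \<psi>_\<phi>: "y \<in> V \<Longrightarrow> \<psi> (\<phi> y) = y" and \<phi>_\<psi>: "y \<in> W \<Longrightarrow> \<phi> (\<psi> y) = y"
  using hom by (auto simp: homeomorphism_def)

lemma \<psi>_M: "y \<in> L \<Longrightarrow> y \<in> W \<Longrightarrow> \<psi> y \<in> M"
  using image_M by (metis (no_types, lifting) IntD1 IntD2 IntI \<psi>_\<phi> imageE)

lemma linear_D: "linear D" and linear_E: "linear E"
  using der_\<psi> der_\<phi> has_derivative_linear by auto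

lemma D_E: "D (E v) = v"
proof -
  have "((\<lambda>y. \<psi> (\<phi> y)) has_derivative (\<lambda>v. D (E v))) (at x)"
    using has_derivative_compose[OF der_\<phi> der_\<psi>] .
  then have "((\<lambda>y. y) has_derivative (\<lambda>v. D (E v))) (at x)"
    by (rule has_derivative_transform_within_open[OF _ open_V x_V]) (simp add: \<psi>_\<phi>)
  from has_derivative_unique[OF this has_derivative_ident] show ?thesis
    by metis
qed

lemma E_D: "E (D v) = v"
proof -
  have "(\<phi> has_derivative E) (at (\<psi> (\<phi> x)))"
    using der_\<phi> by (simp add: \<psi>_\<phi> x_V)
  then have "((\<lambda>y. \<phi> (\<psi> y)) has_derivative (\<lambda>v. E (D v))) (at (\<phi> x))"
    using has_derivative_compose[OF der_\<psi>] by blast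
  then have "((\<lambda>y. y) has_derivative (\<lambda>v. E (D v))) (at (\<phi> x))"
    by (rule has_derivative_transform_within_open[OF _ open_W \<phi>_x(2)]) (simp add: \<phi>_\<psi>)
  from has_derivative_unique[OF this has_derivative_ident] show ?thesis
    by metis
qed

text \<open>A short segment through \<open>\<phi> x\<close> in direction \<open>l\<close> stays in
  \<open>L\<close> and \<open>W\<close>, so \<open>\<psi>\<close> maps it to a curve in
  \<open>M\<close> with velocity \<open>D l\<close>.\<close>

lemma derivative_image_subset_tangent_space: "D ` L \<subseteq> tangent_space M x"
proof clarify
  fix l assume l: "l \<in> L"
  obtain s where s: "0 < s" "ball (\<phi> x) s \<subseteq> W"
    using open_W \<phi>_x(2) open_contains_ball by blast
  define c where "c t = \<psi> (\<phi> x + t *\<^sub>R l)" for t :: real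
  \<comment> \<open>The summand 1 keeps the denominator positive when \<open>l = 0\<close>; for
    parameters below \<open>e\<close> in absolute value the segment stays in the ball of radius
    \<open>s\<close>.\<close>
  define e where "e = s / (norm l + 1)"
  have "0 < e"
    using s by (simp add: e_def add_nonneg_pos)
  moreover have "c t \<in> M" if "t \<in> {-e<..<e}" for t
  proof -
    have "\<bar>t\<bar> * norm l \<le> e * norm l"
      using that by (intro mult_right_mono) auto
    also have "\<dots> < e * (norm l + 1)"
      using \<open>0 < e\<close> by simp
    also have "\<dots> = s"
      unfolding e_def using norm_ge_zero[of l] by (simp add: field_simps add_nonneg_eq_0_iff)
    finally have "\<phi> x + t *\<^sub>R l \<in> W"
      using s(2) by (auto simp: dist_norm)
    moreover have "\<phi> x + t *\<^sub>R l \<in> L"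
      using l L \<phi>_x(1) by (simp add: subspace_add subspace_scale)
    ultimately show ?thesis
      unfolding c_def using \<psi>_M by blast
  qed
  moreover have "c 0 = x"
    by (simp add: c_def \<psi>_\<phi> x_V)
  moreover have "(c has_vector_derivative D l) (at 0)"
  proof -
    have *: "((\<lambda>t. \<phi> x + t *\<^sub>R l) has_derivative (\<lambda>t. t *\<^sub>R l)) (at (0::real))"
      by (auto intro!: derivative_eq_intros)
    have "((\<lambda>t. \<psi> (\<phi> x + t *\<^sub>R l)) has_derivative (\<lambda>t. D (t *\<^sub>R l))) (at (0::real))"
      by (rule has_derivative_compose[OF *]) (simp add: der_\<psi>)
    then show ?thesis
      by (simp add: has_vector_derivative_def c_def[abs_def] linear_scale[OF linear_D])
  qed
  ultimately show "D l \<in> tangent_space M x"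
    unfolding tangent_space_def by blast
qed

text \<open>A curve in \<open>M\<close> is sent by \<open>\<phi>\<close> into \<open>L\<close>, so
  its image has velocity \<open>E v\<close> in \<open>L\<close>, and
  \<open>v = D (E v)\<close>.\<close>

lemma tangent_space_subset_derivative_image: "tangent_space M x \<subseteq> D ` L"
proof
  fix v assume "v \<in> tangent_space M x"
  then obtain c e where c: "0 < e" "\<And>t. t \<in> {-e<..<e} \<Longrightarrow> c t \<in> M" "c 0 = x"
    "(c has_vector_derivative v) (at (0::real))"
    unfolding tangent_space_def by blast
  obtain P where P: "linear P" "\<And>v. P v \<in> L" "\<And>v. v \<in> L \<Longrightarrow> P v = v"
    using orthogonal_projection_exists[OF L] by metis
  \<comment> \<open>This map vanishes exactly on \<open>L\<close>; it turns membership in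
    \<open>L\<close> into an equation that can be differentiated along the curve.\<close>
  have lin: "bounded_linear (\<lambda>w. w - P w)"
    using P(1) by (intro bounded_linear_sub bounded_linear_ident) (simp add: linear_conv_bounded_linear)
  have c': "(c has_derivative (\<lambda>t. t *\<^sub>R v)) (at 0)"
    using c(4) by (simp add: has_vector_derivative_def)
  have "(\<phi> has_derivative E) (at (c 0))"
    using der_\<phi> c(3) by simp
  then have "((\<lambda>t. \<phi> (c t)) has_derivative (\<lambda>t. E (t *\<^sub>R v))) (at 0)"
    by (rule has_derivative_compose[OF c'])
  then have der: "((\<lambda>t. \<phi> (c t) - P (\<phi> (c t))) has_derivative (\<lambda>t. E (t *\<^sub>R v) - P (E (t *\<^sub>R v)))) (at 0)"
    by (rule bounded_linear.has_derivative[OF lin])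
  have "isCont c 0"
    using c(4) has_vector_derivative_continuous by blast
  then have "\<forall>\<^sub>F t in nhds 0. c t \<in> V"
    using open_V x_V c(3) by (simp add: continuous_at_open eventually_nhds)
  moreover have "\<forall>\<^sub>F t in nhds 0. t \<in> {-e<..<e}"
    using c(1) by (intro eventually_nhds_in_open) auto
  ultimately have "\<forall>\<^sub>F t in nhds 0. \<phi> (c t) - P (\<phi> (c t)) = 0"
  proof eventually_elim
    case (elim t)
    then have "\<phi> (c t) \<in> L"
      using image_M c(2)[of t] by blast
    then show ?case
      using P(3) by simp
  qed
  then obtain S where S: "open S" "0 \<in> S" "\<And>t. t \<in> S \<Longrightarrow> \<phi> (c t) - P (\<phi> (c t)) = 0"
    by (auto simp: eventually_nhds)
  have "((\<lambda>_. 0) has_derivative (\<lambda>t. E (t *\<^sub>R v) - P (E (t *\<^sub>R v)))) (at (0::real))"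
    using der S by (rule has_derivative_transform_within_open)
  from has_derivative_unique[OF this has_derivative_const]
  have "E (1 *\<^sub>R v) - P (E (1 *\<^sub>R v)) = 0"
    by metis
  then have "E v \<in> L"
    using P(2)[of "E v"] by simp
  then show "v \<in> D ` L"
    using D_E by (metis imageI)
qed

lemma tangent_space_eq: "tangent_space M x = D ` L"
  using derivative_image_subset_tangent_space tangent_space_subset_derivative_image by blast

lemma subspace_tangent_space: "subspace (tangent_space M x)"
  unfolding tangent_space_eq using linear_D L by (rule linear_subspace_image)

text \<open>
  The map \<open>g y = P (\<psi> y) + (D y - P (D y))\<close>, with \<open>P\<close> the projection onto the tangent space, has derivative \<open>D\<close>
  and sends points outside \<open>L\<close> to points with a nonzero normal component; that it is open at \<open>\<phi> x\<close> needs no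
  continuity of the derivative.
\<close>

lemma manifold_point_over_tangent_ray:
  assumes z: "z \<in> tangent_space M x" "z \<noteq> 0" and \<kappa>: "0 < \<kappa>" and \<delta>: "0 < \<delta>"
  obtains y t where "y \<in> M" "0 < t" "dist x y < \<delta>"
    "\<And>w. w \<in> tangent_space M x \<Longrightarrow> w \<bullet> (y - x - t *\<^sub>R z) = 0" "norm (y - x - t *\<^sub>R z) \<le> \<kappa> * t"
proof -
  let ?T = "tangent_space M x"
  obtain P where P: "linear P" "\<And>v. P v \<in> ?T" "\<And>v w. w \<in> ?T \<Longrightarrow> w \<bullet> (v - P v) = 0"
    "\<And>v. v \<in> ?T \<Longrightarrow> P v = v" "\<And>v. norm (v - P v) \<le> norm v" "\<And>v. norm (P v) \<le> norm v"
    using orthogonal_projection_exists[OF subspace_tangent_space] by metis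
  have blP: "bounded_linear P" and blD: "bounded_linear D" and blE: "bounded_linear E"
    using P(1) linear_D linear_E by (simp_all add: linear_conv_bounded_linear)
  note linear_diff' = linear_diff[OF P(1)] linear_diff[OF linear_D]
  define g where "g y = P (\<psi> y) + (D y - P (D y))" for y
  have der_g: "(g has_derivative D) (at (\<phi> x))"
  proof -
    have "(g has_derivative (\<lambda>h. P (D h) + (D h - P (D h)))) (at (\<phi> x))"
      unfolding g_def[abs_def]
      by (intro derivative_intros bounded_linear.has_derivative[OF blP] der_\<psi>
          bounded_linear.has_derivative[OF blD])
    then show ?thesis by simp
  qed
  have cont_g: "continuous_on W g"
    unfolding g_def[abs_def]
    by (intro continuous_intros bounded_linear.continuous_on[OF blP] bounded_linear.continuous_on[OF blD])
      (use hom in \<open>auto simp: homeomorphism_def\<close>)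
  obtain C where C: "0 < C" "\<And>v. norm (E v) \<le> norm v * C"
    using bounded_linear.pos_bounded[OF blE] by blast
  \<comment> \<open>The first bound lets the term in \<open>norm h\<close> be absorbed when
    \<open>h\<close> is estimated by \<open>t\<close>; the second turns that estimate into the final
    bound \<open>\<kappa> * t\<close>.\<close>
  define \<eta> where "\<eta> = min (1 / (2 * C)) (\<kappa> / (2 * C * norm z))"
  have \<eta>: "0 < \<eta>" "C * \<eta> \<le> 1 / 2" "2 * C * \<eta> * norm z \<le> \<kappa>"
  proof -
    show "0 < \<eta>"
      using C z \<kappa> by (simp add: \<eta>_def)
    have "\<eta> \<le> 1 / (2 * C)" "\<eta> \<le> \<kappa> / (2 * C * norm z)"
      by (auto simp: \<eta>_def)
    then show "C * \<eta> \<le> 1 / 2" "2 * C * \<eta> * norm z \<le> \<kappa>"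
      using C z by (simp_all add: field_simps)
  qed
  obtain d1 where d1: "0 < d1"
    "\<And>y. norm (y - \<phi> x) < d1 \<Longrightarrow> norm (\<psi> y - x - D (y - \<phi> x)) \<le> \<eta> * norm (y - \<phi> x)"
    using der_\<psi> \<eta>(1) by (auto simp: has_derivative_at_alt \<psi>_\<phi> x_V)
  have "isCont \<psi> (\<phi> x)"
    using der_\<psi> has_derivative_continuous by blast
  then obtain d2 where d2: "0 < d2" "\<And>y. dist y (\<phi> x) < d2 \<Longrightarrow> dist (\<psi> y) x < \<delta>"
    using \<delta> by (force simp: continuous_at_eps_delta \<psi>_\<phi> x_V)
  obtain d3 where d3: "0 < d3" "ball (\<phi> x) d3 \<subseteq> W"
    using open_W \<phi>_x(2) open_contains_ball by blast
  \<comment> \<open>The radii control, in turn, the linearization error of \<open>\<psi>\<close>,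
    the distance from \<open>\<psi> y\<close> to \<open>x\<close>, and membership in
    \<open>W\<close>.\<close>
  define S where "S = ball (\<phi> x) (min d1 (min d2 d3))"
  have "\<phi> x \<in> interior S"
    using d1 d2 d3 by (simp add: S_def interior_open)
  moreover have "S \<subseteq> W"
    using d3 by (auto simp: S_def)
  \<comment> \<open>\<open>E\<close> is the bounded right inverse of the derivative of
    \<open>g\<close> that Sussmann's open mapping theorem asks for.\<close>
  moreover have "D \<circ> E = id"
    using D_E by auto
  ultimately have "g (\<phi> x) \<in> interior (g ` S)"
    using sussmann_open_mapping[OF open_W cont_g \<phi>_x(2) der_g blE] by blast
  then obtain e where e: "0 < e" "ball (g (\<phi> x)) e \<subseteq> g ` S"
    unfolding mem_interior by blast
  define t where "t = e / (2 * norm z)"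
  have t: "0 < t"
    using e z by (simp add: t_def)
  have "g (\<phi> x) + t *\<^sub>R z \<in> ball (g (\<phi> x)) e"
    using e z by (simp add: t_def dist_norm)
  then obtain y where y: "y \<in> S" "g y = g (\<phi> x) + t *\<^sub>R z"
    using e(2) by force
  define h where "h = y - \<phi> x"
  define R where "R = \<psi> y - x - D h"
  \<comment> \<open>The left side is orthogonal to the tangent space and the right side lies in it,
    so both vanish. Hence \<open>D h\<close> is tangent, which puts \<open>y\<close> in
    \<open>L\<close>, and the tangential part of \<open>\<psi> y - x\<close> is exactly
    \<open>t *\<^sub>R z\<close>.\<close>
  have normal: "D h - P (D h) = t *\<^sub>R z - P (\<psi> y - x)"
    using y(2) by (simp add: g_def h_def \<psi>_\<phi> x_V linear_diff' algebra_simps)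
  then have "D h - P (D h) \<in> ?T"
    using z P(2) subspace_tangent_space by (simp add: subspace_diff subspace_scale)
  then have "(D h - P (D h)) \<bullet> (D h - P (D h)) = 0"
    by (rule P(3))
  then have PDh: "P (D h) = D h"
    by simp
  with normal have tz: "P (\<psi> y - x) = t *\<^sub>R z"
    by simp
  have "D h \<in> D ` L"
    using P(2)[of "D h"] PDh tangent_space_eq by simp
  then have "h \<in> L"
    using E_D by (metis imageE)
  then have "y \<in> L"
    using L \<phi>_x(1) subspace_add[of L h "\<phi> x"] by (simp add: h_def)
  moreover have "y \<in> W"
    using y(1) \<open>S \<subseteq> W\<close> by blast
  ultimately have M: "\<psi> y \<in> M"
    by (rule \<psi>_M)
  have dist: "dist x (\<psi> y) < \<delta>"
    using y(1) d2(2)[of y] by (simp add: S_def dist_commute)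
  have normR: "norm R \<le> \<eta> * norm h"
    using y(1) d1(2)[of y] by (simp add: S_def R_def h_def dist_norm norm_minus_commute)
  have PR: "P R = t *\<^sub>R z - D h"
    using tz PDh by (simp add: R_def linear_diff')
  \<comment> \<open>The displacement off the ray is the normal part of the linearization error
    \<open>R\<close>, hence small compared with \<open>h\<close>.\<close>
  have rest: "\<psi> y - x - t *\<^sub>R z = R - P R"
    using PR by (simp add: R_def)
  have "norm (D h) = norm (t *\<^sub>R z - P R)"
    by (simp add: PR)
  also have "\<dots> \<le> norm (t *\<^sub>R z) + norm (P R)"
    by (rule norm_triangle_ineq4)
  also have "\<dots> \<le> t * norm z + \<eta> * norm h"
    using P(6)[of R] normR t by simp
  finally have Dh: "norm (D h) \<le> t * norm z + \<eta> * norm h" .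
  have "norm h \<le> norm (D h) * C"
    using C(2)[of "D h"] by (simp add: E_D)
  also have "\<dots> \<le> (t * norm z + \<eta> * norm h) * C"
    using Dh C(1) by (simp add: mult_right_mono)
  also have "\<dots> = t * norm z * C + (C * \<eta>) * norm h"
    by (simp add: algebra_simps)
  also have "\<dots> \<le> t * norm z * C + (1 / 2) * norm h"
    using \<eta>(2) by (intro add_left_mono mult_right_mono) auto
  finally have h: "norm h \<le> 2 * C * t * norm z"
    by (simp add: mult.commute mult.left_commute)
  have "norm (\<psi> y - x - t *\<^sub>R z) \<le> norm R"
    unfolding rest by (rule P(5))
  also have "\<dots> \<le> \<eta> * (2 * C * t * norm z)"
    using normR h \<eta>(1) by (meson mult_left_mono order.trans less_imp_le)
  also have "\<dots> = (2 * C * \<eta> * norm z) * t"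
    by simp
  also have "\<dots> \<le> \<kappa> * t"
    using \<eta>(3) t by (simp add: mult_right_mono)
  finally show thesis
    using that[OF M t dist] rest P(3) by metis
qed

end

lemma Cp_manifold_around_chart:
  assumes "Cp_manifold_around p M x" "1 \<le> p"
  obtains V W L \<phi> \<psi> D E where "straightening_chart M V W L x \<phi> \<psi> D E"
proof -
  obtain V W \<phi> \<psi> and L :: "'a set" where *: "x \<in> M" "open V" "open W" "x \<in> V" "subspace L"
    "homeomorphism V W \<phi> \<psi>" "Ck_on p V \<phi>" "Ck_on p W \<psi>" "\<phi> ` (M \<inter> V) = L \<inter> W"
    using assms(1) unfolding Cp_manifold_around_def by blast
  obtain k where p: "p = Suc k"
    using assms(2) by (cases p) auto
  have "\<phi> x \<in> W"
    using * by (auto simp: homeomorphism_def)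
  then have "(\<phi> has_derivative frechet_derivative \<phi> (at x)) (at x)"
    "(\<psi> has_derivative frechet_derivative \<psi> (at (\<phi> x))) (at (\<phi> x))"
    using * by (simp_all add: p flip: frechet_derivative_works)
  with * that show thesis
    by (simp add: straightening_chart_def)
qed

section \<open>The lifted set\<close>

text \<open>If \<open>x + \<gamma> u = y + \<gamma> v\<close>, then
  \<open>\<gamma> (u - v) = - (x - y)\<close>, and monotonicity scaled by \<open>\<gamma>\<close>
  bounds \<open>(r * \<gamma> - 1)\<close> times the squared distance below by 0, forcing
  \<open>x = y\<close>. Points with empty \<open>B x\<close> contribute nothing to the lifted set,
  whence the intersection with the domain.\<close>

lemma op_image_resolvent_lifted_set:
  fixes B :: "'a::euclidean_space \<Rightarrow> 'a set"
  assumes mono: "monotone_op (\<lambda>x. (\<lambda>u. r *\<^sub>R x + u) ` B x)"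
    and \<gamma>: "0 < \<gamma>" "r * \<gamma> < 1"
  shows "op_image (resolvent \<gamma> B) (lifted_set \<gamma> B S) = S \<inter> op_dom B"
proof -
  have inj: "x = y" if "u \<in> B x" "v \<in> B y" "x + \<gamma> *\<^sub>R u = y + \<gamma> *\<^sub>R v" for x y u v
  proof (rule ccontr)
    assume "x \<noteq> y"
    have "0 \<le> (x - y) \<bullet> ((r *\<^sub>R x + u) - (r *\<^sub>R y + v))"
      using mono that unfolding monotone_op_def by blast
    then have "0 \<le> (x - y) \<bullet> (\<gamma> *\<^sub>R ((r *\<^sub>R x + u) - (r *\<^sub>R y + v)))"
      using \<gamma> by simp
    also have "\<gamma> *\<^sub>R ((r *\<^sub>R x + u) - (r *\<^sub>R y + v)) = (r * \<gamma>) *\<^sub>R (x - y) + (\<gamma> *\<^sub>R u - \<gamma> *\<^sub>R v)"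
      by (simp add: algebra_simps)
    also have "\<gamma> *\<^sub>R u - \<gamma> *\<^sub>R v = - (x - y)"
      using that(3) by (simp add: algebra_simps)
    also have "(x - y) \<bullet> ((r * \<gamma>) *\<^sub>R (x - y) + - (x - y)) = (r * \<gamma> - 1) * ((x - y) \<bullet> (x - y))"
      by (simp add: algebra_simps)
    finally have "0 \<le> (r * \<gamma> - 1) * ((x - y) \<bullet> (x - y))" .
    moreover have "0 < (x - y) \<bullet> (x - y)"
      using \<open>x \<noteq> y\<close> by simp
    ultimately show False
      using \<gamma>(2) mult_neg_pos[of "r * \<gamma> - 1" "(x - y) \<bullet> (x - y)"] by linarith
  qed
  show ?thesis
    unfolding op_image_def resolvent_def op_inverse_def lifted_set_def op_dom_def
    using inj by (auto; blast)
qed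

text \<open>Turns the sequential definition into a uniform statement on a ball. A failure at every
  radius would give a sequence of bad points converging to \<open>x\<close>.\<close>

lemma lsc_at_alongE:
  assumes lsc: "lsc_at_along S A x" and u: "u \<in> A x" and \<eta>: "0 < \<eta>"
    and ne: "\<forall>\<^sub>F y in nhds x. A y \<noteq> {}"
  obtains d where "0 < d" "\<And>y. y \<in> S \<Longrightarrow> dist x y < d \<Longrightarrow> \<exists>v\<in>A y. dist v u < \<eta>"
proof -
  obtain d0 where d0: "0 < d0" "\<And>y. dist y x < d0 \<Longrightarrow> A y \<noteq> {}"
    using ne by (auto simp: eventually_nhds_metric)
  have "\<exists>d>0. \<forall>y\<in>S. dist x y < d \<longrightarrow> (\<exists>v\<in>A y. dist v u < \<eta>)"
  proof (rule ccontr)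
    assume "\<not> ?thesis"
    \<comment> \<open>The bound \<open>d0\<close> keeps the bad points in the domain of
      \<open>A\<close>, since the definition tests only sequences there.\<close>
    then have "\<forall>n. \<exists>y\<in>S. dist x y < min d0 (inverse (real (Suc n))) \<and> \<not> (\<exists>v\<in>A y. dist v u < \<eta>)"
      using d0(1) by (metis min_less_iff_conj inverse_positive_iff_positive of_nat_0_less_iff zero_less_Suc)
    then obtain X where X: "\<And>n. X n \<in> S" "\<And>n. dist x (X n) < d0"
      "\<And>n. dist x (X n) < inverse (real (Suc n))" "\<And>n v. v \<in> A (X n) \<Longrightarrow> \<not> dist v u < \<eta>"
      by (metis min_less_iff_conj)
    have "X \<longlonglongrightarrow> x"
    proof (rule metric_LIMSEQ_I)
      fix e :: real assume "0 < e"
      then obtain N where N: "inverse (real (Suc N)) < e"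
        using reals_Archimedean by blast
      have "dist (X n) x < e" if "N \<le> n" for n
      proof -
        have "inverse (real (Suc n)) \<le> inverse (real (Suc N))"
          using that by (intro le_imp_inverse_le) auto
        then show ?thesis
          using X(3)[of n] N unfolding dist_commute[of _ x] by linarith
      qed
      then show "\<exists>N. \<forall>n\<ge>N. dist (X n) x < e"
        by blast
    qed
    moreover have "X k \<in> S \<inter> op_dom A" for k
      using X(1,2)[of k] d0(2)[of "X k"] by (simp add: op_dom_def dist_commute)
    ultimately obtain Y where Y: "\<And>k. Y k \<in> A (X k)" "Y \<longlonglongrightarrow> u"
      using lsc u unfolding lsc_at_along_def by metis
    from Y(2) \<eta> obtain n where "dist (Y n) u < \<eta>"
      by (meson metric_LIMSEQ_D order_refl)
    with X(4)[OF Y(1)] show False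
      by blast
  qed
  with that show thesis by blast
qed

section \<open>Tools for the spanning claim\<close>

lemma monotone_op_subset:
  "monotone_op B \<Longrightarrow> (\<And>x. C x \<subseteq> B x) \<Longrightarrow> monotone_op C"
  unfolding monotone_op_def by blast

lemma localization_mono: "\<epsilon> \<le> \<epsilon>' \<Longrightarrow> localization A a b \<epsilon> x \<subseteq> localization A a b \<epsilon>' x"
  by (auto simp: localization_def)

lemma span_eq_UNIV_if_orthogonal_trivial:
  fixes S :: "'a::euclidean_space set"
  assumes "\<And>z. (\<And>y. y \<in> S \<Longrightarrow> z \<bullet> y = 0) \<Longrightarrow> z = 0"
  shows "span S = UNIV"
proof (rule ccontr)
  assume "span S \<noteq> UNIV"
  then obtain z where "z \<noteq> 0" "\<And>y. y \<in> span S \<Longrightarrow> orthogonal z y"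
    using orthogonal_to_subspace_exists_gen[of S UNIV] by (auto simp: psubset_eq)
  then show False
    using assms[of z] span_base by (auto simp: orthogonal_def)
qed

text \<open>\<open>u\<close> may lie on the relative boundary, where not every direction of
  \<open>Lin S\<close> is available. Relative interior points are dense in \<open>S\<close>, so a
  nearby one replaces it.\<close>

lemma relative_ball_in_convex:
  fixes S :: "'a::euclidean_space set"
  assumes "convex S" "u \<in> S" "0 < \<epsilon>"
  obtains u\<^sub>0 \<rho> where "u\<^sub>0 \<in> S" "0 < \<rho>"
    "\<And>\<nu>. \<nu> \<in> Lin S \<Longrightarrow> norm \<nu> \<le> \<rho> \<Longrightarrow> u\<^sub>0 + \<nu> \<in> S"
    "\<And>v. dist v u\<^sub>0 \<le> \<rho> \<Longrightarrow> dist v u < \<epsilon>"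
proof -
  have "u \<in> closure (rel_interior S)"
    using assms closure_subset convex_closure_rel_interior by blast
  then obtain u\<^sub>0 where u\<^sub>0: "u\<^sub>0 \<in> rel_interior S" "dist u\<^sub>0 u < \<epsilon>"
    using assms(3) closure_approachable by blast
  then obtain e where e: "u\<^sub>0 \<in> S" "0 < e" "cball u\<^sub>0 e \<inter> affine hull S \<subseteq> S"
    by (auto simp: mem_rel_interior_cball)
  \<comment> \<open>Half of the gap left by \<open>dist u\<^sub>0 u\<close> keeps the closed ball of
    radius \<open>\<rho>\<close> strictly within distance \<open>\<epsilon>\<close> of
    \<open>u\<close>.\<close>
  define \<rho> where "\<rho> = min e ((\<epsilon> - dist u\<^sub>0 u) / 2)"
  have "0 < \<rho>" "\<rho> \<le> e" "dist u\<^sub>0 u + \<rho> < \<epsilon>"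
    using e u\<^sub>0(2) by (auto simp: \<rho>_def min_def field_simps)
  moreover have "u\<^sub>0 + \<nu> \<in> S" if \<nu>: "\<nu> \<in> Lin S" "norm \<nu> \<le> \<rho>" for \<nu>
  proof -
    obtain a b where ab: "\<nu> = b - a" "a \<in> S" "b \<in> affine hull S"
      using \<nu>(1) unfolding Lin_def by blast
    have "u\<^sub>0 + 1 *\<^sub>R (b - a) \<in> affine hull S"
      using mem_affine_3_minus[OF affine_affine_hull hull_inc[OF e(1)] ab(3) hull_inc[OF ab(2)]] .
    moreover have "u\<^sub>0 + \<nu> \<in> cball u\<^sub>0 e"
      using \<nu>(2) \<open>\<rho> \<le> e\<close> by (simp add: dist_norm)
    ultimately show ?thesis
      using e(3) ab(1) by auto
  qed
  moreover have "dist v u < \<epsilon>" if "dist v u\<^sub>0 \<le> \<rho>" for v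
    using that \<open>dist u\<^sub>0 u + \<rho> < \<epsilon>\<close> dist_triangle[of v u u\<^sub>0] by linarith
  ultimately show thesis
    using that e(1) by blast
qed

text \<open>
  With \<open>C\<^sup>1\<close> regularity only, the normal displacement \<open>n\<close> is merely \<open>o(t)\<close>, too large for the second-order estimate.
  Testing monotonicity against \<open>u\<^sub>0 + \<nu>\<close> with \<open>\<nu>\<close> of length \<open>\<rho>\<close> in the direction of \<open>n\<close> cancels its contribution.
\<close>

lemma monotone_normal_perturbation:
  fixes x u x\<^sub>0 u\<^sub>0 n z :: "'a::euclidean_space"
  assumes mono: "\<And>\<nu>. \<nu> \<in> N \<Longrightarrow> norm \<nu> \<le> \<rho> \<Longrightarrow>
      0 \<le> (x - x\<^sub>0) \<bullet> ((r *\<^sub>R x + u) - (r *\<^sub>R x\<^sub>0 + (u\<^sub>0 + \<nu>)))"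
    and N: "subspace N" "n \<in> N" and x: "x - x\<^sub>0 = t *\<^sub>R z + n" and u: "norm (u - u\<^sub>0) \<le> \<rho>"
    and z: "z \<bullet> (x + \<gamma> *\<^sub>R u) = 0" "z \<bullet> (x\<^sub>0 + \<gamma> *\<^sub>R u\<^sub>0) = 0" "\<And>\<nu>. \<nu> \<in> N \<Longrightarrow> z \<bullet> \<nu> = 0"
    and n: "norm n \<le> \<kappa> * t" and pos: "0 < t" "0 < r" "0 < \<gamma>"
  shows "z \<bullet> z \<le> r * \<gamma> * (z \<bullet> z + \<kappa>\<^sup>2)"
proof -
  have \<rho>: "0 \<le> \<rho>"
    using u norm_ge_zero order_trans by blast
  \<comment> \<open>For \<open>n = 0\<close> division by zero gives \<open>\<nu> = 0\<close>, which
    is consistent with \<open>n \<bullet> \<nu> = \<rho> * norm n\<close>.\<close>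
  define \<nu> where "\<nu> = (\<rho> / norm n) *\<^sub>R n"
  have \<nu>: "\<nu> \<in> N" "norm \<nu> \<le> \<rho>"
    using N \<rho> by (auto simp: \<nu>_def subspace_scale)
  have zn: "z \<bullet> n = 0" "z \<bullet> \<nu> = 0" "n \<bullet> z = 0" "\<nu> \<bullet> z = 0"
    using z(3) N(2) \<nu>(1) by (auto simp: inner_commute)
  have n\<nu>: "n \<bullet> \<nu> = \<rho> * norm n"
    by (cases "n = 0") (simp_all add: \<nu>_def dot_square_norm power2_eq_square)
  have "n \<bullet> (u - u\<^sub>0) \<le> norm n * norm (u - u\<^sub>0)"
    by (rule norm_cauchy_schwarz)
  also have "\<dots> \<le> norm n * \<rho>"
    using u by (simp add: mult_left_mono)
  finally have nu: "n \<bullet> (u - u\<^sub>0) - n \<bullet> \<nu> \<le> 0"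
    by (simp add: n\<nu> mult.commute)
  have nn: "n \<bullet> n \<le> \<kappa>\<^sup>2 * t\<^sup>2"
    using power_mono[OF n norm_ge_zero, of 2] by (simp add: power_mult_distrib flip: dot_square_norm)
  have "z \<bullet> (x - x\<^sub>0) + \<gamma> * (z \<bullet> (u - u\<^sub>0)) = 0"
    using z(1,2) by (simp add: algebra_simps)
  \<comment> \<open>Orthogonality at both points fixes the pairing of \<open>z\<close> with
    \<open>u - u\<^sub>0\<close>; it is negative of order \<open>t\<close>, so the factor
    \<open>t\<close> in the monotonicity inequality makes it comparable with the quadratic
    terms.\<close>
  then have zu: "\<gamma> * (z \<bullet> (u - u\<^sub>0)) = - t * (z \<bullet> z)"
    by (simp add: x inner_add_right zn)
  have "0 \<le> (x - x\<^sub>0) \<bullet> ((r *\<^sub>R x + u) - (r *\<^sub>R x\<^sub>0 + (u\<^sub>0 + \<nu>)))"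
    by (rule mono[OF \<nu>])
  also have "(r *\<^sub>R x + u) - (r *\<^sub>R x\<^sub>0 + (u\<^sub>0 + \<nu>)) = r *\<^sub>R (x - x\<^sub>0) + (u - u\<^sub>0) - \<nu>"
    by (simp add: algebra_simps)
  also have "(x - x\<^sub>0) \<bullet> (r *\<^sub>R (x - x\<^sub>0) + (u - u\<^sub>0) - \<nu>)
      = r * (t\<^sup>2 * (z \<bullet> z) + n \<bullet> n) + t * (z \<bullet> (u - u\<^sub>0)) + (n \<bullet> (u - u\<^sub>0) - n \<bullet> \<nu>)"
    unfolding x inner_add_left inner_add_right inner_diff_right[of _ _ \<nu>] inner_scaleR_left inner_scaleR_right zn
    by (simp add: power2_eq_square algebra_simps)
  also have "\<dots> \<le> r * (t\<^sup>2 * (z \<bullet> z) + \<kappa>\<^sup>2 * t\<^sup>2) + t * (z \<bullet> (u - u\<^sub>0))"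
    using nu mult_left_mono[OF nn, of r] pos(2) unfolding distrib_left by linarith
  finally have "0 \<le> \<gamma> * (r * (t\<^sup>2 * (z \<bullet> z) + \<kappa>\<^sup>2 * t\<^sup>2) + t * (z \<bullet> (u - u\<^sub>0)))"
    using pos by simp
  also have "\<dots> = \<gamma> * (r * (t\<^sup>2 * (z \<bullet> z) + \<kappa>\<^sup>2 * t\<^sup>2)) + t * (\<gamma> * (z \<bullet> (u - u\<^sub>0)))"
    by (simp add: algebra_simps)
  also have "\<dots> = t\<^sup>2 * (r * \<gamma> * (z \<bullet> z + \<kappa>\<^sup>2) - z \<bullet> z)"
    unfolding zu by (simp add: power2_eq_square algebra_simps)
  finally show ?thesis
    using pos by (simp add: zero_le_mult_iff)
qed

text \<open>The radius \<open>\<delta>\<close> of base points is independent of the localization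
  radius \<open>\<epsilon>\<close>, so the result covers both \<open>\<delta> = \<epsilon>\<close>
  and arbitrarily small \<open>\<delta>\<close>.\<close>

lemma span_lifted_set_eq_UNIV:
  fixes A :: "'a::euclidean_space \<Rightarrow> 'a set"
  assumes man: "Cp_manifold_around p M xbar" "1 \<le> p"
    and conv: "convex (A xbar)" and ubar: "ubar \<in> A xbar"
    and ne: "\<forall>\<^sub>F x in nhds xbar. A x \<noteq> {}"
    and normal: "normal_space M xbar = Lin (A xbar)"
    and lsc: "lsc_at_along M A xbar"
    and mono: "monotone_op (\<lambda>x. (\<lambda>u. r *\<^sub>R x + u) ` localization A xbar ubar \<epsilon> x)"
    and pos: "0 < r" "0 < \<gamma>" "r * \<gamma> < 1" "0 < \<epsilon>" "0 < \<delta>"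
  shows "span (lifted_set \<gamma> (localization A xbar ubar \<epsilon>) (M \<inter> ball xbar \<delta>)) = UNIV"
proof (rule span_eq_UNIV_if_orthogonal_trivial, rule ccontr)
  let ?B = "localization A xbar ubar \<epsilon>"
  let ?T = "tangent_space M xbar"
  fix z assume orth: "\<And>y. y \<in> lifted_set \<gamma> ?B (M \<inter> ball xbar \<delta>) \<Longrightarrow> z \<bullet> y = 0"
    and "z \<noteq> 0"
  obtain V W L \<phi> \<psi> D E where "straightening_chart M V W L xbar \<phi> \<psi> D E"
    using Cp_manifold_around_chart[OF man] .
  then interpret straightening_chart M V W L xbar \<phi> \<psi> D E .
  have orth': "z \<bullet> (x + \<gamma> *\<^sub>R u) = 0" if "x \<in> M" "dist xbar x < \<delta>" "u \<in> ?B x" for x u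
    using that by (intro orth) (auto simp: lifted_set_def)
  obtain u\<^sub>0 \<rho> where u\<^sub>0: "u\<^sub>0 \<in> A xbar" "0 < \<rho>"
    "\<And>\<nu>. \<nu> \<in> Lin (A xbar) \<Longrightarrow> norm \<nu> \<le> \<rho> \<Longrightarrow> u\<^sub>0 + \<nu> \<in> A xbar"
    "\<And>v. dist v u\<^sub>0 \<le> \<rho> \<Longrightarrow> dist v ubar < \<epsilon>"
    using relative_ball_in_convex[OF conv ubar pos(4)] by metis
  have N: "subspace (Lin (A xbar))"
    by (metis normal normal_space_def subspace_orthogonal_comp)
  have B: "u\<^sub>0 + \<nu> \<in> ?B xbar" if "\<nu> \<in> Lin (A xbar)" "norm \<nu> \<le> \<rho>" for \<nu>
    using u\<^sub>0(3)[OF that] u\<^sub>0(4)[of "u\<^sub>0 + \<nu>"] that(2) pos(4) by (simp add: localization_def dist_norm)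
  have zu\<^sub>0: "z \<bullet> (xbar + \<gamma> *\<^sub>R u\<^sub>0) = 0"
    using orth'[of xbar u\<^sub>0] B[of 0] x_M pos u\<^sub>0(2) subspace_0[OF N] by simp
  have zN: "z \<bullet> \<nu> = 0" if "\<nu> \<in> Lin (A xbar)" for \<nu>
  proof (cases "\<nu> = 0")
    case False
    \<comment> \<open>Scaling to length \<open>\<rho>\<close> keeps
      \<open>u\<^sub>0 + s *\<^sub>R \<nu>\<close> in the localization; subtracting the
      orthogonality relations at \<open>xbar\<close> then isolates
      \<open>z \<bullet> \<nu>\<close>.\<close>
    define s where "s = \<rho> / norm \<nu>"
    have s: "s \<noteq> 0" "s *\<^sub>R \<nu> \<in> Lin (A xbar)" "norm (s *\<^sub>R \<nu>) \<le> \<rho>"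
      using u\<^sub>0(2) False that N by (auto simp: s_def subspace_scale)
    have "z \<bullet> (xbar + \<gamma> *\<^sub>R (u\<^sub>0 + s *\<^sub>R \<nu>)) = 0"
      using B[OF s(2,3)] x_M pos by (intro orth') auto
    then have "\<gamma> * (s * (z \<bullet> \<nu>)) = 0"
      using zu\<^sub>0 unfolding inner_add_right inner_scaleR_right distrib_left by linarith
    then show ?thesis
      using s(1) pos(2) by simp
  qed simp
  have "z \<in> (?T\<^sup>\<bottom>)\<^sup>\<bottom>"
    using zN normal by (auto simp: orthogonal_comp_def orthogonal_def inner_commute normal_space_def)
  then have zT: "z \<in> ?T"
    using orthogonal_comp_self[OF subspace_tangent_space] by simp
  obtain d where d: "0 < d" "\<And>y. y \<in> M \<Longrightarrow> dist xbar y < d \<Longrightarrow> \<exists>v\<in>A y. dist v u\<^sub>0 < \<rho>"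
    using lsc_at_alongE[OF lsc u\<^sub>0(1,2) ne] by metis
  have zz: "0 < z \<bullet> z"
    using \<open>z \<noteq> 0\<close> by simp
  \<comment> \<open>Chosen so that \<open>r * \<gamma> * (z \<bullet> z + \<kappa>\<^sup>2)\<close>
    equals \<open>(1 + r * \<gamma>) / 2\<close> times \<open>z \<bullet> z\<close>, which is
    strictly below \<open>z \<bullet> z\<close>.\<close>
  define \<kappa> where "\<kappa> = sqrt ((1 - r * \<gamma>) / (2 * (r * \<gamma>)) * (z \<bullet> z))"
  have \<kappa>: "0 < \<kappa>" "\<kappa>\<^sup>2 = (1 - r * \<gamma>) / (2 * (r * \<gamma>)) * (z \<bullet> z)"
    using pos zz by (simp_all add: \<kappa>_def)
  \<comment> \<open>Here \<open>d\<close> provides a value of \<open>A x\<close> near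
    \<open>u\<^sub>0\<close>, \<open>\<delta>\<close> makes \<open>x\<close> a base point of the
    lifted set, and \<open>\<epsilon>\<close> keeps \<open>x\<close> in the localization.\<close>
  obtain x t where x: "x \<in> M" "0 < t" "dist xbar x < min d (min \<delta> \<epsilon>)"
    "\<And>w. w \<in> ?T \<Longrightarrow> w \<bullet> (x - xbar - t *\<^sub>R z) = 0" "norm (x - xbar - t *\<^sub>R z) \<le> \<kappa> * t"
    using manifold_point_over_tangent_ray[OF zT \<open>z \<noteq> 0\<close> \<kappa>(1), of "min d (min \<delta> \<epsilon>)"] d(1) pos
    by (metis min_less_iff_conj)
  obtain u where u: "u \<in> A x" "dist u u\<^sub>0 < \<rho>"
    using d(2)[OF x(1)] x(3) by auto
  have uB: "u \<in> ?B x"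
    using u u\<^sub>0(4)[of u] x(3) by (simp add: localization_def dist_norm norm_minus_commute)
  have "z \<bullet> z \<le> r * \<gamma> * (z \<bullet> z + \<kappa>\<^sup>2)"
  proof (rule monotone_normal_perturbation)
    show "0 \<le> (x - xbar) \<bullet> ((r *\<^sub>R x + u) - (r *\<^sub>R xbar + (u\<^sub>0 + \<nu>)))"
      if "\<nu> \<in> Lin (A xbar)" "norm \<nu> \<le> \<rho>" for \<nu>
      using mono uB B[OF that] unfolding monotone_op_def by blast
    show "x - xbar - t *\<^sub>R z \<in> Lin (A xbar)"
      using x(4) normal by (auto simp: normal_space_def orthogonal_comp_def orthogonal_def)
    show "z \<bullet> (x + \<gamma> *\<^sub>R u) = 0"
      using x uB by (intro orth') auto
  qed (use N x u zu\<^sub>0 zN pos in \<open>auto simp: dist_norm\<close>)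
  also have "\<dots> = (z \<bullet> z) * ((1 + r * \<gamma>) / 2)"
    unfolding \<kappa>(2) using pos by (simp add: field_simps)
  also have "\<dots> < (z \<bullet> z) * 1"
    using pos zz by (intro mult_strict_left_mono) auto
  finally show False
    by simp
qed

section \<open>Choice of the localization radius and of the radius of base points\<close>

theorem proposition4:
  fixes A :: "real ^ 'n \<Rightarrow> (real ^ 'n) set"
    and M :: "(real ^ 'n) set"
    and xbar ubar :: "real ^ 'n"
    and p :: nat
    and r \<gamma> :: real
  assumes "1 \<le> p"
    and "partly_smooth p A xbar M"
    and "ubar \<in> A xbar"
    and "resolvent_regular r A xbar ubar"
    and "0 < \<gamma>" and "\<gamma> < 1 / r"
  shows "\<forall>\<^sub>F \<epsilon> in at_right 0.
    (let A\<^sub>\<epsilon> = localization A xbar ubar \<epsilon>;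
         U = (\<lambda>\<delta>. lifted_set \<gamma> A\<^sub>\<epsilon> (M \<inter> ball xbar \<delta>))
     in span (U \<epsilon>) = UNIV \<and>
        op_image (resolvent \<gamma> A\<^sub>\<epsilon>) (U \<epsilon>) = M \<inter> ball xbar \<epsilon> \<inter> op_dom A\<^sub>\<epsilon> \<and>
        (\<forall>\<^sub>F \<delta> in at_right 0.
           span (U \<delta>) = UNIV \<and>
           op_image (resolvent \<gamma> A\<^sub>\<epsilon>) (U \<delta>) = M \<inter> ball xbar \<delta>))"
proof -
  have man: "Cp_manifold_around p M xbar"
    and reg: "\<forall>\<^sub>F x in nhds xbar. A x \<noteq> {} \<and> closed (A x) \<and> convex (A x)"
    and normal: "normal_space M xbar = Lin (A xbar)"
    and cont: "\<forall>\<^sub>F x in nhds xbar. x \<in> M \<longrightarrow> lsc_at_along M A x \<and> usc_at_along M A x"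
    using assms(2) by (auto simp: partly_smooth_def)
  have ne: "\<forall>\<^sub>F x in nhds xbar. A x \<noteq> {}"
    using reg by eventually_elim simp
  have conv: "convex (A xbar)"
    using eventually_nhds_x_imp_x[OF reg] by simp
  have lsc: "lsc_at_along M A xbar"
    using eventually_nhds_x_imp_x[OF cont] man by (simp add: Cp_manifold_around_def)
  obtain \<epsilon>\<^sub>0 where r: "0 < r" and \<epsilon>\<^sub>0: "0 < \<epsilon>\<^sub>0"
    "monotone_op (\<lambda>x. (\<lambda>u. r *\<^sub>R x + u) ` localization A xbar ubar \<epsilon>\<^sub>0 x)"
    using assms(4) unfolding resolvent_regular_def by blast
  have r\<gamma>: "r * \<gamma> < 1"
    using assms(6) r by (simp add: field_simps)
  have "\<forall>\<^sub>F \<epsilon> in at_right 0. 0 < \<epsilon> \<and> \<epsilon> < \<epsilon>\<^sub>0"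
    using \<epsilon>\<^sub>0(1) by (auto simp: eventually_at_right_field)
  then show ?thesis
  proof eventually_elim
    case (elim \<epsilon>)
    let ?B = "localization A xbar ubar \<epsilon>"
    \<comment> \<open>Monotonicity is inherited from the radius \<open>\<epsilon>\<^sub>0\<close>,
      as shrinking the radius shrinks the graph.\<close>
    have mono: "monotone_op (\<lambda>x. (\<lambda>u. r *\<^sub>R x + u) ` ?B x)"
      using elim by (intro monotone_op_subset[OF \<epsilon>\<^sub>0(2)] image_mono localization_mono) simp
    note span = span_lifted_set_eq_UNIV[OF man assms(1) conv assms(3) ne normal lsc mono r assms(5) r\<gamma>]
    note image = op_image_resolvent_lifted_set[OF mono assms(5) r\<gamma>]
    \<comment> \<open>Lower semicontinuity at \<open>ubar\<close> with tolerance
      \<open>\<epsilon>\<close> makes the localization nonempty at points of \<open>M\<close> near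
      \<open>xbar\<close>, so for small \<open>\<delta>\<close> the domain restriction in the image
      formula disappears.\<close>
    obtain d where d: "0 < d" "\<And>y. y \<in> M \<Longrightarrow> dist xbar y < d \<Longrightarrow> \<exists>v\<in>A y. dist v ubar < \<epsilon>"
      using lsc_at_alongE[OF lsc assms(3) _ ne] elim by metis
    have dom: "M \<inter> ball xbar \<delta> \<inter> op_dom ?B = M \<inter> ball xbar \<delta>" if "\<delta> < min d \<epsilon>" for \<delta>
      using d(2) that
      by (fastforce simp: op_dom_def localization_def dist_norm norm_minus_commute)
    have "\<forall>\<^sub>F \<delta> in at_right 0. 0 < \<delta> \<and> \<delta> < min d \<epsilon>"
      using d(1) elim by (auto simp: eventually_at_right_field intro!: exI[of _ "min d \<epsilon>"])
    then have "\<forall>\<^sub>F \<delta> in at_right 0. span (lifted_set \<gamma> ?B (M \<inter> ball xbar \<delta>)) = UNIV \<and>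
        op_image (resolvent \<gamma> ?B) (lifted_set \<gamma> ?B (M \<inter> ball xbar \<delta>)) = M \<inter> ball xbar \<delta>"
      by eventually_elim (use elim in \<open>simp add: span image dom\<close>)
    then show ?case
      using elim by (simp add: Let_def span image)
  qed
qed

end
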